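(* Let $S\in\mathcal{IC}$ be an idempotent covered semigroup with a zero element $0$. Then $S$ is $0$-simple (respectively $0$-bisimple, completely $0$-simple) if and only if $T^*(S)$ is $0$-simple (respectively $0$-bisimple, completely $0$-simple).
   Context: For a semigroup $S$, $E(S)$ denotes its set of idempotents, and $S^1$ denotes $S$ itself if $S$ is a monoid, and otherwise $S$ with an identity $1$ adjoined. $S$ is idempotent covered ($S\in\mathcal{IC}$) if for every $s\in S$ there are $e,f\in E(S)$ with $se=s=fs$. Let $R_2=\{\sigma,\tau\}$ be the two-element right-zero semigroup, and let $T*R_2$ be the set $S\times S\times R_2$ with product $(t_1,s_1,\sigma)(t_2,s_2,\alpha_2)=(t_1s_2,\,s_1s_2,\,\alpha_2)$ and $(t_1,s_1,\tau)(t_2,s_2,\alpha_2)=(t_1t_2,\,s_1t_2,\,\alpha_2)$ (a semidirect product of $T=S\times S$ by $R_2$). Let $E=\{(s,t,\alpha)\in E(T*R_2):\ s\in S^1t\}$ and $T(S)=\langle E\rangle$, the subsemigroup generated by $E$; for $S\in\mathcal{IC}$ one has $T(S)=\{(s,t,\alpha)\in T*R_2: s\in S^1t\}$. If $S$ has a zero $0$, then $\overline{0}=\{(0,0,\sigma),(0,0,\tau)\}$ is the minimal ideal of $T(S)$, and $T^*(S)=T(S)/\overline{0}$ is the Rees quotient. A semigroup $A$ with $0$ is $0$-simple [$0$-bisimple] if $\{0\}$ and $A\setminus\{0\}$ are its only $\mathcal{J}$-classes [$\mathcal{D}$-classes] and $A$ is not a null semigroup (i.e. $A^2\neq\{0\}$).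 A non-zero idempotent $e$ is primitive if for all idempotents $f$, $ef=fe=f\neq0$ implies $e=f$. A completely $0$-simple semigroup is a $0$-simple semigroup with a primitive idempotent. *)

theory Defs
  imports "HOL-Algebra.Congruence"
begin

record 'a sgrp = "'a partial_object" +
  mult :: "['a, 'a] \<Rightarrow> 'a"  (infixl "\<cdot>\<index>" 70)

locale semigrp =
  fixes A :: "'a sgrp"  (structure)
  assumes mult_closed: "\<lbrakk>x \<in> carrier A; y \<in> carrier A\<rbrakk> \<Longrightarrow> x \<cdot> y \<in> carrier A"
    and mult_assoc: "\<lbrakk>x \<in> carrier A; y \<in> carrier A; w \<in> carrier A\<rbrakk>
          \<Longrightarrow> (x \<cdot> y) \<cdot> w = x \<cdot> (y \<cdot> w)"

locale semigrp_with_zero = semigrp +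
  fixes z :: 'a
  assumes zero_closed: "z \<in> carrier A"
    and zero_left: "x \<in> carrier A \<Longrightarrow> z \<cdot> x = z"
    and zero_right: "x \<in> carrier A \<Longrightarrow> x \<cdot> z = z"

definition idempotents :: "('a, 'm) sgrp_scheme \<Rightarrow> 'a set" where
  "idempotents A = {e \<in> carrier A. e \<cdot>\<^bsub>A\<^esub> e = e}"

definition idempotent_covered :: "'a sgrp \<Rightarrow> bool" where
  "idempotent_covered A \<longleftrightarrow>
     (\<forall>s\<in>carrier A. \<exists>e\<in>idempotents A. \<exists>f\<in>idempotents A.
        s \<cdot>\<^bsub>A\<^esub> e = s \<and> f \<cdot>\<^bsub>A\<^esub> s = s)"

definition has_identity :: "'a sgrp \<Rightarrow> bool" where
  "has_identity A \<longleftrightarrow>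
     (\<exists>u\<in>carrier A. \<forall>x\<in>carrier A. u \<cdot>\<^bsub>A\<^esub> x = x \<and> x \<cdot>\<^bsub>A\<^esub> u = x)"

text \<open>The semigroup \<open>A\<^sup>1\<close>: the original elements are embedded by \<^term>\<open>Some\<close>, and
  \<^term>\<open>None\<close> is the adjoined identity, which belongs to the carrier only when \<open>A\<close> has no
  identity of its own.\<close>

fun mult1 :: "('a \<Rightarrow> 'a \<Rightarrow> 'a) \<Rightarrow> 'a option \<Rightarrow> 'a option \<Rightarrow> 'a option" where
  "mult1 m (Some x) (Some y) = Some (m x y)"
| "mult1 m None v = v"
| "mult1 m u None = u"

definition adjoin_one :: "'a sgrp \<Rightarrow> 'a option sgrp" where
  "adjoin_one A =
     \<lparr>carrier = Some ` carrier A \<union> (if has_identity A then {} else {None}),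
      mult = mult1 (mult A)\<rparr>"

text \<open>\<open>A\<^sup>1 a\<close>, \<open>a A\<^sup>1\<close> and \<open>A\<^sup>1 a A\<^sup>1\<close>, as sets of elements of \<open>A\<close>.\<close>

definition left_ideal1 :: "'a sgrp \<Rightarrow> 'a \<Rightarrow> 'a set" where
  "left_ideal1 A a =
     {x. \<exists>u\<in>carrier (adjoin_one A). Some x = u \<cdot>\<^bsub>adjoin_one A\<^esub> Some a}"

definition right_ideal1 :: "'a sgrp \<Rightarrow> 'a \<Rightarrow> 'a set" where
  "right_ideal1 A a =
     {x. \<exists>v\<in>carrier (adjoin_one A). Some x = Some a \<cdot>\<^bsub>adjoin_one A\<^esub> v}"

definition ideal1 :: "'a sgrp \<Rightarrow> 'a \<Rightarrow> 'a set" where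
  "ideal1 A a =
     {x. \<exists>u\<in>carrier (adjoin_one A). \<exists>v\<in>carrier (adjoin_one A).
           Some x = u \<cdot>\<^bsub>adjoin_one A\<^esub> Some a \<cdot>\<^bsub>adjoin_one A\<^esub> v}"

definition green_L :: "'a sgrp \<Rightarrow> 'a rel" where
  "green_L A = {(a, b) \<in> carrier A \<times> carrier A. left_ideal1 A a = left_ideal1 A b}"

definition green_R :: "'a sgrp \<Rightarrow> 'a rel" where
  "green_R A = {(a, b) \<in> carrier A \<times> carrier A. right_ideal1 A a = right_ideal1 A b}"

definition green_J :: "'a sgrp \<Rightarrow> 'a rel" where
  "green_J A = {(a, b) \<in> carrier A \<times> carrier A. ideal1 A a = ideal1 A b}"

definition green_D :: "'a sgrp \<Rightarrow> 'a rel" where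
  "green_D A = green_L A O green_R A"

definition null_semigrp :: "'a sgrp \<Rightarrow> 'a \<Rightarrow> bool" where
  "null_semigrp A z \<longleftrightarrow> {x \<cdot>\<^bsub>A\<^esub> y | x y. x \<in> carrier A \<and> y \<in> carrier A} = {z}"

definition zero_simple :: "'a sgrp \<Rightarrow> 'a \<Rightarrow> bool" where
  "zero_simple A z \<longleftrightarrow> semigrp_with_zero A z \<and>
     carrier A // green_J A = {{z}, carrier A - {z}} \<and> \<not> null_semigrp A z"

definition zero_bisimple :: "'a sgrp \<Rightarrow> 'a \<Rightarrow> bool" where
  "zero_bisimple A z \<longleftrightarrow> semigrp_with_zero A z \<and>
     carrier A // green_D A = {{z}, carrier A - {z}} \<and> \<not> null_semigrp A z"

definition primitive_idempotent :: "'a sgrp \<Rightarrow> 'a \<Rightarrow> 'a \<Rightarrow> bool" where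
  "primitive_idempotent A z e \<longleftrightarrow> e \<in> idempotents A \<and> e \<noteq> z \<and>
     (\<forall>f\<in>idempotents A. e \<cdot>\<^bsub>A\<^esub> f = f \<and> f \<cdot>\<^bsub>A\<^esub> e = f \<and> f \<noteq> z \<longrightarrow> e = f)"

definition completely_zero_simple :: "'a sgrp \<Rightarrow> 'a \<Rightarrow> bool" where
  "completely_zero_simple A z \<longleftrightarrow> zero_simple A z \<and> (\<exists>e. primitive_idempotent A z e)"

inductive_set generate_semigrp :: "'a sgrp \<Rightarrow> 'a set \<Rightarrow> 'a set"
  for A :: "'a sgrp" and X :: "'a set" where
  incl: "x \<in> X \<Longrightarrow> x \<in> generate_semigrp A X"
| mult: "\<lbrakk>x \<in> generate_semigrp A X; y \<in> generate_semigrp A X\<rbrakk>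
    \<Longrightarrow> x \<cdot>\<^bsub>A\<^esub> y \<in> generate_semigrp A X"

text \<open>The Rees quotient by an ideal \<open>I\<close>: the classes of the congruence \<open>(I \<times> I) \<union> Id\<close>, namely \<open>I\<close>
  and the singletons outside \<open>I\<close>. The product of two classes is the class containing their
  elementwise product.\<close>

definition rees_cong :: "'a sgrp \<Rightarrow> 'a set \<Rightarrow> 'a rel" where
  "rees_cong A I = (I \<times> I) \<union> Id_on (carrier A)"

definition rees_quotient :: "'a sgrp \<Rightarrow> 'a set \<Rightarrow> 'a set sgrp" where
  "rees_quotient A I =
     \<lparr>carrier = carrier A // rees_cong A I,
      mult = (\<lambda>X Y. rees_cong A I `` {x \<cdot>\<^bsub>A\<^esub> y | x y. x \<in> X \<and> y \<in> Y})\<rparr>"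

text \<open>The underlying set of the two-element right-zero semigroup; its product \<open>\<alpha>\<^sub>1 \<alpha>\<^sub>2 = \<alpha>\<^sub>2\<close>
  is built into the last component below.\<close>

datatype R2 = Sigma2 | Tau2

fun semidirect_mult :: "('a \<Rightarrow> 'a \<Rightarrow> 'a) \<Rightarrow> 'a \<times> 'a \<times> R2 \<Rightarrow> 'a \<times> 'a \<times> R2 \<Rightarrow> 'a \<times> 'a \<times> R2" where
  "semidirect_mult m (t1, s1, Sigma2) (t2, s2, \<alpha>2) = (m t1 s2, m s1 s2, \<alpha>2)"
| "semidirect_mult m (t1, s1, Tau2) (t2, s2, \<alpha>2) = (m t1 t2, m s1 t2, \<alpha>2)"

definition semidirect_R2 :: "'a sgrp \<Rightarrow> ('a \<times> 'a \<times> R2) sgrp" where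
  "semidirect_R2 S =
     \<lparr>carrier = carrier S \<times> carrier S \<times> UNIV, mult = semidirect_mult (mult S)\<rparr>"

definition T_generators :: "'a sgrp \<Rightarrow> ('a \<times> 'a \<times> R2) set" where
  "T_generators S =
     {(s, t, \<alpha>). (s, t, \<alpha>) \<in> idempotents (semidirect_R2 S) \<and> s \<in> left_ideal1 S t}"

definition T_semigrp :: "'a sgrp \<Rightarrow> ('a \<times> 'a \<times> R2) sgrp" where
  "T_semigrp S =
     (semidirect_R2 S)\<lparr>carrier := generate_semigrp (semidirect_R2 S) (T_generators S)\<rparr>"

definition zero_bar :: "'a \<Rightarrow> ('a \<times> 'a \<times> R2) set" where
  "zero_bar z = {(z, z, Sigma2), (z, z, Tau2)}"

definition T_star :: "'a sgrp \<Rightarrow> 'a \<Rightarrow> ('a \<times> 'a \<times> R2) set sgrp" where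
  "T_star S z = rees_quotient (T_semigrp S) (zero_bar z)"

end

theory Submission
  imports Defs
begin

text \<open>Write a triple \<open>(s, t, \<alpha>)\<close> of \<open>T(S)\<close> as a pair \<open>(s, t) = (v t, t)\<close> together with a
  selector \<open>\<alpha>\<close>. A product \<open>(s, t, \<alpha>) (s', t', \<alpha>')\<close> is \<open>(s x, t x, \<alpha>')\<close>, where \<open>x\<close> is the entry
  of \<open>(s', t')\<close> that \<open>\<alpha>\<close> selects. So right multiplication acts on both entries at once and
  preserves the factor \<open>v\<close>, while left multiplication may replace \<open>v\<close> by anything. It
  follows that the position of a triple in the ideal structure of \<open>T(S)\<close> is decided by
  its second entry \<open>t\<close>: triples are \<open>\<J>\<close>- or \<open>\<D>\<close>-related exactly when their second entries
  are so in \<open>S\<close> (\<open>T_semigrp_factor_iff\<close>, \<open>T_semigrp_bisimilar_iff\<close>). A triple with \<open>t = 0\<close> also has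
  \<open>s = v 0 = 0\<close>, so \<open>t \<noteq> 0\<close> describes exactly the triples that survive in the Rees quotient.

  In an idempotent triple, the entry picked by its own selector is an idempotent of \<open>S\<close>, and
  the nonzero idempotents of \<open>S\<close> below that entry lift to idempotents below the triple;
  in the other direction, the triples below \<open>(e, e, \<sigma>)\<close> are the \<open>(g, g, \<sigma>)\<close> with \<open>g\<close> below \<open>e\<close>.
  This transfers primitive idempotents both ways.

  Idempotent coverage enters twice. It gives every element of \<open>S\<close>, hence of \<open>T(S)\<close> and of
  its quotient, a left and a right unit, so that Green's relations and the absence of a null
  multiplication can be described without an adjoined identity; and it provides the
  idempotents whose products exhaust all triples with \<open>s \<in> S t\<close>.\<close>


section \<open>Green's relations in locally unital semigroups\<close>

locale locally_unital_semigrp = semigrp +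
  assumes left_unit: "x \<in> carrier A \<Longrightarrow> \<exists>f\<in>carrier A. f \<cdot> x = x"
    and right_unit: "x \<in> carrier A \<Longrightarrow> \<exists>e\<in>carrier A. x \<cdot> e = x"
begin

lemma left_ideal1_iff:
  assumes "a \<in> carrier A"
  shows "x \<in> left_ideal1 A a \<longleftrightarrow> (\<exists>u\<in>carrier A. x = u \<cdot> a)"
  using left_unit[OF assms]
  by (auto simp: left_ideal1_def adjoin_one_def bex_Un) metis

lemma right_ideal1_iff:
  assumes "a \<in> carrier A"
  shows "x \<in> right_ideal1 A a \<longleftrightarrow> (\<exists>v\<in>carrier A. x = a \<cdot> v)"
  using right_unit[OF assms]
  by (auto simp: right_ideal1_def adjoin_one_def bex_Un) metis

lemma ideal1_iff:
  assumes a: "a \<in> carrier A"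
  shows "x \<in> ideal1 A a \<longleftrightarrow> (\<exists>u\<in>carrier A. \<exists>v\<in>carrier A. x = u \<cdot> a \<cdot> v)"
proof
  obtain f e where f: "f \<in> carrier A" "f \<cdot> a = a" and e: "e \<in> carrier A" "a \<cdot> e = a"
    using left_unit[OF a] right_unit[OF a] by blast
  assume "x \<in> ideal1 A a"
  then obtain u v where u: "u \<in> carrier (adjoin_one A)" and v: "v \<in> carrier (adjoin_one A)"
    and x: "Some x = mult1 (mult A) (mult1 (mult A) u (Some a)) v"
    by (auto simp: ideal1_def adjoin_one_def)
  obtain u' where u': "u' \<in> carrier A" "mult1 (mult A) u (Some a) = Some (u' \<cdot> a)"
    using u f by (cases u) (auto simp: adjoin_one_def split: if_splits)
  show "\<exists>u\<in>carrier A. \<exists>v\<in>carrier A. x = u \<cdot> a \<cdot> v"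
  proof (cases v)
    case None
    then have "x = u' \<cdot> a \<cdot> e" using x u' e a by (simp add: mult_assoc)
    then show ?thesis using u' e by blast
  next
    case (Some w)
    then have "w \<in> carrier A" using v by (auto simp: adjoin_one_def split: if_splits)
    then show ?thesis using x u' Some by auto
  qed
next
  assume "\<exists>u\<in>carrier A. \<exists>v\<in>carrier A. x = u \<cdot> a \<cdot> v"
  then show "x \<in> ideal1 A a"
    by (force simp: ideal1_def adjoin_one_def)
qed

lemma green_L_iff:
  "(a, b) \<in> green_L A \<longleftrightarrow> a \<in> carrier A \<and> b \<in> carrier A \<and>
     (\<exists>u\<in>carrier A. a = u \<cdot> b) \<and> (\<exists>u\<in>carrier A. b = u \<cdot> a)"
proof (cases "a \<in> carrier A \<and> b \<in> carrier A")
  case True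
  then have a: "a \<in> carrier A" and b: "b \<in> carrier A" by auto
  have sub: "left_ideal1 A c \<subseteq> left_ideal1 A d"
    if "u \<in> carrier A" "c = u \<cdot> d" "c \<in> carrier A" "d \<in> carrier A" for u c d
    using that by (auto simp: left_ideal1_iff) (metis mult_closed mult_assoc)
  have self: "c \<in> left_ideal1 A c" if "c \<in> carrier A" for c
    using left_unit[OF that] that by (simp add: left_ideal1_iff) metis
  show ?thesis
    using a b sub self[OF a] self[OF b]
    by (simp add: green_L_def) (metis left_ideal1_iff subset_antisym)
qed (auto simp: green_L_def)

lemma green_R_iff:
  "(a, b) \<in> green_R A \<longleftrightarrow> a \<in> carrier A \<and> b \<in> carrier A \<and>
     (\<exists>v\<in>carrier A. a = b \<cdot> v) \<and> (\<exists>v\<in>carrier A. b = a \<cdot> v)"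
proof (cases "a \<in> carrier A \<and> b \<in> carrier A")
  case True
  then have a: "a \<in> carrier A" and b: "b \<in> carrier A" by auto
  have sub: "right_ideal1 A c \<subseteq> right_ideal1 A d"
    if "v \<in> carrier A" "c = d \<cdot> v" "c \<in> carrier A" "d \<in> carrier A" for v c d
    using that by (auto simp: right_ideal1_iff) (metis mult_closed mult_assoc)
  have self: "c \<in> right_ideal1 A c" if "c \<in> carrier A" for c
    using right_unit[OF that] that by (simp add: right_ideal1_iff) metis
  show ?thesis
    using a b sub self[OF a] self[OF b]
    by (simp add: green_R_def) (metis right_ideal1_iff subset_antisym)
qed (auto simp: green_R_def)

definition factors_through :: "'a \<Rightarrow> 'a \<Rightarrow> bool" where
  "factors_through a b \<longleftrightarrow> (\<exists>u\<in>carrier A. \<exists>v\<in>carrier A. a = u \<cdot> b \<cdot> v)"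

lemma factors_through_refl:
  assumes "a \<in> carrier A"
  shows "factors_through a a"
  using left_unit[OF assms] right_unit[OF assms] unfolding factors_through_def by metis

lemma factors_through_trans:
  assumes "factors_through a b" "factors_through b c" "c \<in> carrier A"
  shows "factors_through a c"
proof -
  obtain u v u' v' where *: "u \<in> carrier A" "v \<in> carrier A" "u' \<in> carrier A" "v' \<in> carrier A"
    and "a = u \<cdot> b \<cdot> v" "b = u' \<cdot> c \<cdot> v'"
    using assms(1,2) unfolding factors_through_def by blast
  then have "a = (u \<cdot> u') \<cdot> c \<cdot> (v' \<cdot> v)"
    using assms(3) by (simp add: mult_assoc mult_closed)
  then show ?thesis using * mult_closed unfolding factors_through_def by blast
qed

lemma green_J_iff:
  "(a, b) \<in> green_J A \<longleftrightarrow>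
     a \<in> carrier A \<and> b \<in> carrier A \<and> factors_through a b \<and> factors_through b a"
proof (cases "a \<in> carrier A \<and> b \<in> carrier A")
  case True
  have mem: "x \<in> ideal1 A c \<longleftrightarrow> factors_through x c" if "c \<in> carrier A" for x c
    using that by (simp add: ideal1_iff factors_through_def)
  show ?thesis
    using True by (simp add: green_J_def set_eq_iff mem)
      (metis factors_through_refl factors_through_trans)
qed (auto simp: green_J_def)

text \<open>This is \<open>\<D> = \<L> \<circ> \<R>\<close>, with the linking element \<open>c\<close> explicit: \<open>a \<L> c \<R> b\<close>.\<close>

definition bisimilar :: "'a \<Rightarrow> 'a \<Rightarrow> bool" where
  "bisimilar a b \<longleftrightarrow> (\<exists>c\<in>carrier A.
     (\<exists>u\<in>carrier A. a = u \<cdot> c) \<and> (\<exists>u\<in>carrier A. c = u \<cdot> a) \<and>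
     (\<exists>v\<in>carrier A. c = b \<cdot> v) \<and> (\<exists>v\<in>carrier A. b = c \<cdot> v))"

lemma green_D_iff:
  "(a, b) \<in> green_D A \<longleftrightarrow> a \<in> carrier A \<and> b \<in> carrier A \<and> bisimilar a b"
  by (auto simp: green_D_def relcomp_unfold green_L_iff green_R_iff bisimilar_def)

end

text \<open>The quotient is read as the set of all \<open>r `` {a}\<close>, for a reflexive relation \<open>r\<close> that
  separates \<open>z\<close> from the rest. This covers both \<open>\<J>\<close> and the composition
  \<open>\<D> = \<L> \<circ> \<R>\<close>.\<close>

lemma quotient_zero_and_rest_iff:
  assumes "r \<subseteq> C \<times> C" and refl: "\<And>a. a \<in> C \<Longrightarrow> (a, a) \<in> r" and "z \<in> C"
    and left: "\<And>c. (z, c) \<in> r \<Longrightarrow> c = z" and right: "\<And>c. (c, z) \<in> r \<Longrightarrow> c = z"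
  shows "C // r = {{z}, C - {z}} \<longleftrightarrow> C \<noteq> {z} \<and> (\<forall>a\<in>C - {z}. \<forall>b\<in>C - {z}. (a, b) \<in> r)"
proof
  assume q: "C // r = {{z}, C - {z}}"
  have "C \<noteq> {z}"
  proof
    assume "C = {z}"
    then have "{} \<in> C // r" using q by auto
    then show False using refl by (auto simp: quotient_def)
  qed
  moreover have "(a, b) \<in> r" if "a \<in> C - {z}" "b \<in> C - {z}" for a b
  proof -
    have "r `` {a} \<in> C // r" using that by (auto intro: quotientI)
    then have "r `` {a} = C - {z}" using q refl[of a] that by auto
    then show ?thesis using that by blast
  qed
  ultimately show "C \<noteq> {z} \<and> (\<forall>a\<in>C - {z}. \<forall>b\<in>C - {z}. (a, b) \<in> r)" by blast
next
  assume *: "C \<noteq> {z} \<and> (\<forall>a\<in>C - {z}. \<forall>b\<in>C - {z}. (a, b) \<in> r)"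
  have zero: "r `` {z} = {z}" using left refl \<open>z \<in> C\<close> by auto
  have rest: "r `` {a} = C - {z}" if "a \<in> C - {z}" for a
    using that * right[of a] assms(1) by auto
  obtain a where "a \<in> C - {z}" using * \<open>z \<in> C\<close> by blast
  then show "C // r = {{z}, C - {z}}"
    using zero rest \<open>z \<in> C\<close> by (auto simp: quotient_def)
qed

locale locally_unital_semigrp_with_zero = locally_unital_semigrp + semigrp_with_zero
begin

lemma zero_factor:
  "factors_through a z \<Longrightarrow> a = z"
  "bisimilar z c \<Longrightarrow> c \<in> carrier A \<Longrightarrow> c = z"
  "bisimilar c z \<Longrightarrow> c \<in> carrier A \<Longrightarrow> c = z"
  by (auto simp: factors_through_def bisimilar_def zero_left zero_right)

text \<open>With right units \<open>A A = A\<close>, so only the trivial semigroup is null.\<close>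

lemma null_semigrp_iff: "null_semigrp A z \<longleftrightarrow> carrier A = {z}"
proof -
  have "{x \<cdot> y | x y. x \<in> carrier A \<and> y \<in> carrier A} = carrier A"
  proof
    show "carrier A \<subseteq> {x \<cdot> y | x y. x \<in> carrier A \<and> y \<in> carrier A}"
    proof
      fix x assume x: "x \<in> carrier A"
      then obtain e where "e \<in> carrier A" "x \<cdot> e = x" using right_unit by blast
      then show "x \<in> {x \<cdot> y | x y. x \<in> carrier A \<and> y \<in> carrier A}"
        using x by (metis (mono_tags, lifting) mem_Collect_eq)
    qed
  qed (auto intro: mult_closed)
  then show ?thesis by (simp add: null_semigrp_def)
qed

lemma zero_simple_iff:
  "zero_simple A z \<longleftrightarrow> carrier A \<noteq> {z} \<and>
     (\<forall>a\<in>carrier A - {z}. \<forall>b\<in>carrier A - {z}. factors_through a b)"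
proof -
  have "carrier A // green_J A = {{z}, carrier A - {z}} \<longleftrightarrow> carrier A \<noteq> {z} \<and>
     (\<forall>a\<in>carrier A - {z}. \<forall>b\<in>carrier A - {z}. (a, b) \<in> green_J A)"
    by (rule quotient_zero_and_rest_iff)
      (auto simp: green_J_iff zero_closed factors_through_refl zero_factor)
  then show ?thesis
    by (auto simp: zero_simple_def null_semigrp_iff green_J_iff semigrp_with_zero_axioms)
qed

lemma zero_bisimple_iff:
  "zero_bisimple A z \<longleftrightarrow> carrier A \<noteq> {z} \<and>
     (\<forall>a\<in>carrier A - {z}. \<forall>b\<in>carrier A - {z}. bisimilar a b)"
proof -
  have refl: "bisimilar a a" if "a \<in> carrier A" for a
    using that left_unit[OF that] right_unit[OF that] unfolding bisimilar_def by metis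
  have "carrier A // green_D A = {{z}, carrier A - {z}} \<longleftrightarrow> carrier A \<noteq> {z} \<and>
     (\<forall>a\<in>carrier A - {z}. \<forall>b\<in>carrier A - {z}. (a, b) \<in> green_D A)"
    by (rule quotient_zero_and_rest_iff)
      (auto simp: green_D_iff zero_closed refl zero_factor)
  then show ?thesis
    by (auto simp: zero_bisimple_def null_semigrp_iff green_D_iff semigrp_with_zero_axioms)
qed

end


section \<open>Rees quotients\<close>

locale rees_ideal = locally_unital_semigrp +
  fixes I
  assumes ideal_subset: "I \<subseteq> carrier A" and ideal_nonempty: "I \<noteq> {}"
    and ideal_left: "\<lbrakk>x \<in> carrier A; i \<in> I\<rbrakk> \<Longrightarrow> x \<cdot> i \<in> I"
    and ideal_right: "\<lbrakk>i \<in> I; x \<in> carrier A\<rbrakk> \<Longrightarrow> i \<cdot> x \<in> I"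
begin

abbreviation "Q \<equiv> rees_quotient A I"

definition rees_class :: "'a \<Rightarrow> 'a set" where
  "rees_class x = (if x \<in> I then I else {x})"

lemma rees_class_eq_iff: "rees_class x = rees_class y \<longleftrightarrow> x = y \<or> x \<in> I \<and> y \<in> I"
  by (auto simp: rees_class_def)

lemma rees_class_eq_ideal_iff: "rees_class x = I \<longleftrightarrow> x \<in> I"
  by (auto simp: rees_class_def)

lemma carrier_rees: "carrier Q = rees_class ` carrier A"
proof -
  have "rees_cong A I `` {x} = rees_class x" if "x \<in> carrier A" for x
    using that ideal_subset by (auto simp: rees_cong_def rees_class_def)
  then show ?thesis by (auto simp: rees_quotient_def quotient_def)
qed

text \<open>The projection \<open>rees_class\<close> is a homomorphism, which reduces every computation in the
  quotient to one in \<open>A\<close>.\<close>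

lemma mult_rees:
  assumes x: "x \<in> carrier A" and y: "y \<in> carrier A"
  shows "rees_class x \<cdot>\<^bsub>Q\<^esub> rees_class y = rees_class (x \<cdot> y)"
proof (cases "x \<in> I \<or> y \<in> I")
  case True
  let ?P = "{a \<cdot> b | a b. a \<in> rees_class x \<and> b \<in> rees_class y}"
  have "x \<in> rees_class x" "y \<in> rees_class y" by (auto simp: rees_class_def)
  then have "x \<cdot> y \<in> ?P" by blast
  moreover have "?P \<subseteq> I"
    using True x y ideal_left ideal_right ideal_subset
    by (auto simp: rees_class_def split: if_splits)
  ultimately have "rees_cong A I `` ?P = I" by (auto simp: rees_cong_def)
  then show ?thesis
    using subsetD[OF \<open>?P \<subseteq> I\<close> \<open>x \<cdot> y \<in> ?P\<close>] by (simp add: rees_quotient_def rees_class_def)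
next
  case False
  then show ?thesis
    using mult_closed[OF x y] by (auto simp: rees_quotient_def rees_class_def rees_cong_def)
qed

lemma rees_ideal_class: "\<exists>i\<in>I. rees_class i = I"
  using ideal_nonempty by (auto simp: rees_class_def)

sublocale rees: locally_unital_semigrp_with_zero Q I
proof
  fix X Y W assume X: "X \<in> carrier Q" and Y: "Y \<in> carrier Q" and W: "W \<in> carrier Q"
  then obtain x y w where "x \<in> carrier A" "y \<in> carrier A" "w \<in> carrier A"
    "X = rees_class x" "Y = rees_class y" "W = rees_class w"
    by (auto simp: carrier_rees)
  then show "X \<cdot>\<^bsub>Q\<^esub> Y \<cdot>\<^bsub>Q\<^esub> W = X \<cdot>\<^bsub>Q\<^esub> (Y \<cdot>\<^bsub>Q\<^esub> W)"
    by (simp add: mult_rees mult_closed mult_assoc)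
next
  fix X Y assume X: "X \<in> carrier Q" and Y: "Y \<in> carrier Q"
  then show "X \<cdot>\<^bsub>Q\<^esub> Y \<in> carrier Q"
    by (auto simp: carrier_rees mult_rees mult_closed)
next
  fix X assume X: "X \<in> carrier Q"
  then obtain x where x: "x \<in> carrier A" "X = rees_class x" by (auto simp: carrier_rees)
  show "\<exists>F\<in>carrier Q. F \<cdot>\<^bsub>Q\<^esub> X = X"
    using left_unit[OF x(1)] x by (auto simp: carrier_rees) (metis mult_rees)
  show "\<exists>E\<in>carrier Q. X \<cdot>\<^bsub>Q\<^esub> E = X"
    using right_unit[OF x(1)] x by (auto simp: carrier_rees) (metis mult_rees)
  obtain i where i: "i \<in> I" "rees_class i = I" using rees_ideal_class by blast
  have "I \<cdot>\<^bsub>Q\<^esub> X = rees_class (i \<cdot> x)"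
    using mult_rees[of i x] i x ideal_subset by auto
  then show "I \<cdot>\<^bsub>Q\<^esub> X = I"
    using ideal_right i x by (simp add: rees_class_eq_ideal_iff)
  have "X \<cdot>\<^bsub>Q\<^esub> I = rees_class (x \<cdot> i)"
    using mult_rees[of x i] i x ideal_subset by auto
  then show "X \<cdot>\<^bsub>Q\<^esub> I = I"
    using ideal_left i x by (simp add: rees_class_eq_ideal_iff)
next
  show "I \<in> carrier Q"
    using rees_ideal_class ideal_subset unfolding carrier_rees by blast
qed

lemma rees_trivial_iff: "carrier Q = {I} \<longleftrightarrow> carrier A = I"
proof -
  have "carrier Q = {I} \<longleftrightarrow> (\<forall>X\<in>carrier Q. X = I)"
    using rees.zero_closed by blast
  also have "\<dots> \<longleftrightarrow> (\<forall>x\<in>carrier A. x \<in> I)"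
    by (simp add: carrier_rees rees_class_eq_ideal_iff)
  finally show ?thesis using ideal_subset by blast
qed

lemma nonzero_rees_ball:
  "(\<forall>X\<in>carrier Q - {I}. P X) \<longleftrightarrow> (\<forall>x\<in>carrier A - I. P (rees_class x))"
  unfolding carrier_rees using rees_class_eq_ideal_iff by blast

text \<open>Equations between elements outside \<open>I\<close> lift from the quotient, because the class of such
  an element is a singleton.\<close>

lemma rees_factors_through_iff:
  assumes "x \<in> carrier A - I" "y \<in> carrier A"
  shows "rees.factors_through (rees_class x) (rees_class y) \<longleftrightarrow> factors_through x y"
  using assms
  by (auto simp: rees.factors_through_def factors_through_def carrier_rees mult_rees mult_closed
      rees_class_eq_iff)

text \<open>A linking element for \<open>x\<close> is automatically outside \<open>I\<close>, since \<open>x\<close> is a multiple of it.\<close>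

lemma rees_bisimilar_iff:
  assumes x: "x \<in> carrier A - I" and y: "y \<in> carrier A - I"
  shows "rees.bisimilar (rees_class x) (rees_class y) \<longleftrightarrow> bisimilar x y"
proof -
  have lift: "rees_class c = rees_class d \<longleftrightarrow> c = d" if "c \<notin> I \<or> d \<notin> I" for c d
    using that by (auto simp: rees_class_eq_iff)
  have "rees.bisimilar (rees_class x) (rees_class y) \<longleftrightarrow> (\<exists>c\<in>carrier A.
     (\<exists>u\<in>carrier A. x = u \<cdot> c) \<and> (\<exists>u\<in>carrier A. rees_class c = rees_class (u \<cdot> x)) \<and>
     (\<exists>v\<in>carrier A. rees_class c = rees_class (y \<cdot> v)) \<and> (\<exists>v\<in>carrier A. y = c \<cdot> v))"
    using x y by (simp add: rees.bisimilar_def carrier_rees mult_rees lift)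
  also have "\<dots> \<longleftrightarrow> bisimilar x y"
    unfolding bisimilar_def
  proof (intro bex_cong refl)
    fix c assume c: "c \<in> carrier A"
    have "c \<notin> I" if "\<exists>u\<in>carrier A. x = u \<cdot> c" using that x ideal_left by auto
    then show "((\<exists>u\<in>carrier A. x = u \<cdot> c) \<and> (\<exists>u\<in>carrier A. rees_class c = rees_class (u \<cdot> x)) \<and>
       (\<exists>v\<in>carrier A. rees_class c = rees_class (y \<cdot> v)) \<and> (\<exists>v\<in>carrier A. y = c \<cdot> v)) =
      ((\<exists>u\<in>carrier A. x = u \<cdot> c) \<and> (\<exists>u\<in>carrier A. c = u \<cdot> x) \<and>
       (\<exists>v\<in>carrier A. c = y \<cdot> v) \<and> (\<exists>v\<in>carrier A. y = c \<cdot> v))"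
      by (cases "\<exists>u\<in>carrier A. x = u \<cdot> c") (simp_all add: lift)
  qed
  finally show ?thesis .
qed

lemma rees_zero_simple_iff:
  "zero_simple Q I \<longleftrightarrow> carrier A \<noteq> I \<and>
     (\<forall>a\<in>carrier A - I. \<forall>b\<in>carrier A - I. factors_through a b)"
  unfolding rees.zero_simple_iff rees_trivial_iff nonzero_rees_ball
  by (simp add: rees_factors_through_iff)

lemma rees_zero_bisimple_iff:
  "zero_bisimple Q I \<longleftrightarrow> carrier A \<noteq> I \<and>
     (\<forall>a\<in>carrier A - I. \<forall>b\<in>carrier A - I. bisimilar a b)"
  unfolding rees.zero_bisimple_iff rees_trivial_iff nonzero_rees_ball
  by (simp add: rees_bisimilar_iff)

lemma rees_primitive_idempotent_iff:
  "(\<exists>X. primitive_idempotent Q I X) \<longleftrightarrow>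
     (\<exists>e\<in>idempotents A - I. \<forall>f\<in>idempotents A - I. e \<cdot> f = f \<and> f \<cdot> e = f \<longrightarrow> e = f)"
proof -
  have idem: "rees_class x \<in> idempotents Q \<longleftrightarrow> x \<in> idempotents A" if "x \<in> carrier A - I" for x
    using that by (auto simp: idempotents_def carrier_rees mult_rees rees_class_eq_iff)
  have nonzero: "idempotents Q - {I} = rees_class ` (idempotents A - I)"
  proof (intro equalityI subsetI)
    fix X assume X: "X \<in> idempotents Q - {I}"
    then have "X \<in> rees_class ` carrier A" by (simp add: idempotents_def carrier_rees)
    then obtain x where "x \<in> carrier A" "X = rees_class x" by blast
    then show "X \<in> rees_class ` (idempotents A - I)"
      using X idem[of x] rees_class_eq_ideal_iff[of x] by blast
  next
    fix X assume "X \<in> rees_class ` (idempotents A - I)"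
    then obtain x where "x \<in> idempotents A - I" "X = rees_class x" by blast
    then show "X \<in> idempotents Q - {I}"
      using idem[of x] rees_class_eq_ideal_iff[of x] by (auto simp: idempotents_def)
  qed
  have "(\<exists>X. primitive_idempotent Q I X) \<longleftrightarrow>
     (\<exists>X\<in>idempotents Q - {I}. \<forall>Y\<in>idempotents Q - {I}. X \<cdot>\<^bsub>Q\<^esub> Y = Y \<and> Y \<cdot>\<^bsub>Q\<^esub> X = Y \<longrightarrow> X = Y)"
    unfolding primitive_idempotent_def Bex_def by (rule ex_cong1) auto
  also have "\<dots> \<longleftrightarrow>
     (\<exists>e\<in>idempotents A - I. \<forall>f\<in>idempotents A - I. e \<cdot> f = f \<and> f \<cdot> e = f \<longrightarrow> e = f)"
    unfolding nonzero by (auto simp: idempotents_def mult_rees rees_class_eq_iff)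
  finally show ?thesis .
qed

end


section \<open>The semigroup \<open>T(S)\<close> of an idempotent covered semigroup\<close>

fun select :: "R2 \<Rightarrow> 'a \<Rightarrow> 'a \<Rightarrow> 'a" where
  "select Sigma2 s t = t"
| "select Tau2 s t = s"

lemma select_same [simp]: "select \<alpha> x x = x"
  by (cases \<alpha>) auto

text \<open>The two cases of the product differ only in the entry of the right factor that is read,
  so one formula serves both.\<close>

lemma semidirect_mult_select:
  "semidirect_mult m (s, t, \<alpha>) (s', t', \<beta>) = (m s (select \<alpha> s' t'), m t (select \<alpha> s' t'), \<beta>)"
  by (cases \<alpha>) auto

locale idempotent_covered_semigrp = semigrp S for S (structure) +
  assumes covered: "idempotent_covered S"
begin

lemma right_idempotent:
  assumes "x \<in> carrier S" obtains e where "e \<in> carrier S" "e \<cdot> e = e" "x \<cdot> e = x"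
  using covered assms unfolding idempotent_covered_def idempotents_def by blast

lemma left_idempotent:
  assumes "x \<in> carrier S" obtains f where "f \<in> carrier S" "f \<cdot> f = f" "f \<cdot> x = x"
  using covered assms unfolding idempotent_covered_def idempotents_def by blast

sublocale locally_unital_semigrp S
  by unfold_locales (metis left_idempotent, metis right_idempotent)

text \<open>Left units make \<open>S\<^sup>1 t = S t\<close>, hence the factor \<open>v\<close> ranges over \<open>S\<close> itself.\<close>

definition triples :: "('a \<times> 'a \<times> R2) set" where
  "triples = {(s, t, \<alpha>). t \<in> carrier S \<and> (\<exists>v\<in>carrier S. s = v \<cdot> t)}"

lemma triple_iff: "(s, t, \<alpha>) \<in> triples \<longleftrightarrow> t \<in> carrier S \<and> (\<exists>v\<in>carrier S. s = v \<cdot> t)"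
  by (simp add: triples_def)

lemma triple_closed:
  assumes "(s, t, \<alpha>) \<in> triples"
  shows "s \<in> carrier S" "t \<in> carrier S"
  using assms by (auto simp: triple_iff mult_closed)

lemma select_closed:
  "(s, t, \<alpha>) \<in> triples \<Longrightarrow> select \<beta> s t \<in> carrier S"
  by (cases \<beta>) (auto simp: triple_closed)

lemma diagonal_triple: "x \<in> carrier S \<Longrightarrow> (x, x, \<alpha>) \<in> triples"
  using left_unit[of x] by (auto simp: triple_iff) metis

lemma triple_act:
  "(s, t, \<alpha>) \<in> triples \<Longrightarrow> x \<in> carrier S \<Longrightarrow> (s \<cdot> x, t \<cdot> x, \<beta>) \<in> triples"
  by (auto simp: triple_iff mult_closed) (metis mult_assoc)

lemma T_generators_iff:
  "(s, t, \<alpha>) \<in> T_generators S \<longleftrightarrow>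
     (s, t, \<alpha>) \<in> triples \<and> s \<cdot> select \<alpha> s t = s \<and> t \<cdot> select \<alpha> s t = t"
proof (cases "t \<in> carrier S")
  case True
  then show ?thesis
    by (auto simp: T_generators_def idempotents_def semidirect_R2_def semidirect_mult_select
        triple_iff left_ideal1_iff mult_closed)
qed (auto simp: T_generators_def idempotents_def semidirect_R2_def triple_iff)

text \<open>For \<open>s = v t\<close> and idempotents with \<open>f t = t = t e\<close>, the triple factors as
  \<open>(v t, t, \<alpha>) = (v f, f, \<sigma>) (f, f, \<tau>) (t, e, \<sigma>) (e, e, \<alpha>)\<close>. The third factor carries the
  arbitrary element \<open>t\<close> in its first entry, where an idempotent triple with selector \<open>\<sigma>\<close> is free;
  the second switches the selector so that this entry is read; the first inserts \<open>v\<close>; and the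
  last sets the selector.\<close>

lemma triples_generated:
  assumes "(s, t, \<alpha>) \<in> triples"
  shows "(s, t, \<alpha>) \<in> generate_semigrp (semidirect_R2 S) (T_generators S)"
    (is "_ \<in> ?G")
proof -
  obtain v where t: "t \<in> carrier S" and v: "v \<in> carrier S" "s = v \<cdot> t"
    using assms by (auto simp: triple_iff)
  obtain e f where e: "e \<in> carrier S" "e \<cdot> e = e" "t \<cdot> e = t"
    and f: "f \<in> carrier S" "f \<cdot> f = f" "f \<cdot> t = t"
    using t left_idempotent right_idempotent by metis
  have mult: "semidirect_mult (mult S) x y \<in> ?G" if "x \<in> ?G" "y \<in> ?G" for x y
    using generate_semigrp.mult[OF that] by (simp add: semidirect_R2_def)
  have "(v \<cdot> f, f, Sigma2) \<in> ?G"
    using v f by (auto intro!: generate_semigrp.incl simp: T_generators_iff triple_iff mult_assoc)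
  moreover have "(f, f, Tau2) \<in> ?G"
    using f by (auto intro!: generate_semigrp.incl simp: T_generators_iff diagonal_triple)
  ultimately have left: "(v \<cdot> f, f, Tau2) \<in> ?G"
    using mult[of "(v \<cdot> f, f, Sigma2)" "(f, f, Tau2)"] v f by (simp add: mult_assoc)
  have "(t, e, Sigma2) \<in> T_generators S"
    using e t by (auto simp: T_generators_iff triple_iff intro: bexI[of _ t])
  then have "(t, e, Sigma2) \<in> ?G" by (rule generate_semigrp.incl)
  then have sig: "(s, t, Sigma2) \<in> ?G"
    using mult[OF left, of "(t, e, Sigma2)"] v f t by (simp add: mult_assoc)
  have "(e, e, \<alpha>) \<in> ?G"
    using e by (auto intro!: generate_semigrp.incl simp: T_generators_iff diagonal_triple)
  then show ?thesis
    using mult[OF sig, of "(e, e, \<alpha>)"] v e t by (simp add: mult_assoc)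
qed

lemma carrier_T: "carrier (T_semigrp S) = triples"
proof -
  have "x \<in> triples" if "x \<in> generate_semigrp (semidirect_R2 S) (T_generators S)" for x
    using that
  proof induction
    case (incl x)
    then show ?case by (cases x) (simp add: T_generators_iff)
  next
    case (mult x y)
    obtain s t \<alpha> where "x = (s, t, \<alpha>)" by (cases x)
    moreover obtain s' t' \<beta> where "y = (s', t', \<beta>)" by (cases y)
    ultimately show ?case
      using mult.IH by (simp add: semidirect_R2_def semidirect_mult_select triple_act select_closed)
  qed
  then show ?thesis
    using triples_generated by (auto simp: T_semigrp_def)
qed

lemma mult_T:
  "(s, t, \<alpha>) \<cdot>\<^bsub>T_semigrp S\<^esub> (s', t', \<beta>) = (s \<cdot> select \<alpha> s' t', t \<cdot> select \<alpha> s' t', \<beta>)"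
  by (simp add: T_semigrp_def semidirect_R2_def semidirect_mult_select)

lemma select_mult: "select \<alpha> (s \<cdot> x) (t \<cdot> x) = select \<alpha> s t \<cdot> x"
  by (cases \<alpha>) auto

sublocale T: locally_unital_semigrp "T_semigrp S"
proof
  fix x y w
  assume "x \<in> carrier (T_semigrp S)" "y \<in> carrier (T_semigrp S)" "w \<in> carrier (T_semigrp S)"
  then show "x \<cdot>\<^bsub>T_semigrp S\<^esub> y \<cdot>\<^bsub>T_semigrp S\<^esub> w = x \<cdot>\<^bsub>T_semigrp S\<^esub> (y \<cdot>\<^bsub>T_semigrp S\<^esub> w)"
    by (cases x; cases y; cases w)
      (simp add: carrier_T mult_T select_mult mult_assoc triple_closed select_closed)
next
  fix x y
  assume "x \<in> carrier (T_semigrp S)" "y \<in> carrier (T_semigrp S)"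
  then show "x \<cdot>\<^bsub>T_semigrp S\<^esub> y \<in> carrier (T_semigrp S)"
    by (cases x; cases y) (simp add: carrier_T mult_T triple_act select_closed)
next
  fix x
  assume "x \<in> carrier (T_semigrp S)"
  then obtain s t \<alpha> v where x: "x = (s, t, \<alpha>)" and t: "t \<in> carrier S"
    and v: "v \<in> carrier S" "s = v \<cdot> t"
    by (cases x) (auto simp: carrier_T triple_iff)
  obtain e f where e: "e \<in> carrier S" "t \<cdot> e = t" and f: "f \<in> carrier S" "f \<cdot> t = t"
    using t left_unit right_unit by metis
  have "(v \<cdot> f, f, Sigma2) \<cdot>\<^bsub>T_semigrp S\<^esub> x = x"
    using x v f t by (simp add: mult_T mult_assoc)
  moreover have "(v \<cdot> f, f, Sigma2) \<in> carrier (T_semigrp S)"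
    using v f by (auto simp: carrier_T triple_iff)
  ultimately show "\<exists>f\<in>carrier (T_semigrp S). f \<cdot>\<^bsub>T_semigrp S\<^esub> x = x" by blast
  have "x \<cdot>\<^bsub>T_semigrp S\<^esub> (e, e, \<alpha>) = x"
    using x v e t by (simp add: mult_T mult_assoc)
  moreover have "(e, e, \<alpha>) \<in> carrier (T_semigrp S)"
    using e by (simp add: carrier_T diagonal_triple)
  ultimately show "\<exists>e\<in>carrier (T_semigrp S). x \<cdot>\<^bsub>T_semigrp S\<^esub> e = x" by blast
qed

text \<open>Since the diagonal triples \<open>(x, x, \<beta>)\<close> are available and selectors cannot tell their
  entries apart, a right multiplier is just an element of \<open>S\<close> together with a selector.\<close>

lemma right_multiple_T_iff:
  assumes "(s, t, \<alpha>) \<in> triples"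
  shows "(\<exists>w\<in>carrier (T_semigrp S). (a, b, \<beta>) = (s, t, \<alpha>) \<cdot>\<^bsub>T_semigrp S\<^esub> w) \<longleftrightarrow>
     (\<exists>x\<in>carrier S. a = s \<cdot> x \<and> b = t \<cdot> x)"
proof
  assume "\<exists>w\<in>carrier (T_semigrp S). (a, b, \<beta>) = (s, t, \<alpha>) \<cdot>\<^bsub>T_semigrp S\<^esub> w"
  then show "\<exists>x\<in>carrier S. a = s \<cdot> x \<and> b = t \<cdot> x"
    by (auto simp: carrier_T mult_T select_closed)
next
  assume "\<exists>x\<in>carrier S. a = s \<cdot> x \<and> b = t \<cdot> x"
  then obtain x where x: "x \<in> carrier S" "a = s \<cdot> x" "b = t \<cdot> x" by blast
  then have "(a, b, \<beta>) = (s, t, \<alpha>) \<cdot>\<^bsub>T_semigrp S\<^esub> (x, x, \<beta>)" by (simp add: mult_T)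
  then show "\<exists>w\<in>carrier (T_semigrp S). (a, b, \<beta>) = (s, t, \<alpha>) \<cdot>\<^bsub>T_semigrp S\<^esub> w"
    using x by (auto simp: carrier_T diagonal_triple)
qed

text \<open>Left multiples of \<open>(s, t, \<alpha>)\<close> do not see \<open>s\<close>: a multiplier \<open>(v q, q, \<sigma>)\<close> reads only \<open>t\<close>
  and produces \<open>(v q t, q t, \<alpha>)\<close> with \<open>v\<close> and \<open>q\<close> free. A multiplier with selector \<open>\<tau>\<close> reads
  \<open>s\<close>, but \<open>s \<in> S t\<close>.\<close>

lemma left_multiple_T_iff:
  assumes st: "(s, t, \<alpha>) \<in> triples" and ab: "(a, b, \<beta>) \<in> triples"
  shows "(\<exists>w\<in>carrier (T_semigrp S). (a, b, \<beta>) = w \<cdot>\<^bsub>T_semigrp S\<^esub> (s, t, \<alpha>)) \<longleftrightarrow>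
     \<beta> = \<alpha> \<and> (\<exists>q\<in>carrier S. b = q \<cdot> t)"
proof
  assume "\<exists>w\<in>carrier (T_semigrp S). (a, b, \<beta>) = w \<cdot>\<^bsub>T_semigrp S\<^esub> (s, t, \<alpha>)"
  then obtain p q \<gamma> where pq: "(p, q, \<gamma>) \<in> triples" and "b = q \<cdot> select \<gamma> s t" "\<beta> = \<alpha>"
    by (auto simp: carrier_T mult_T)
  moreover obtain u where "u \<in> carrier S" "select \<gamma> s t = u \<cdot> t"
    using st left_unit[of t] by (cases \<gamma>) (auto simp: triple_iff)
  ultimately have "b = (q \<cdot> u) \<cdot> t" "q \<cdot> u \<in> carrier S"
    using triple_closed[OF pq] triple_closed[OF st] by (auto simp: mult_assoc mult_closed)
  then show "\<beta> = \<alpha> \<and> (\<exists>q\<in>carrier S. b = q \<cdot> t)" using \<open>\<beta> = \<alpha>\<close> by blast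
next
  assume "\<beta> = \<alpha> \<and> (\<exists>q\<in>carrier S. b = q \<cdot> t)"
  then obtain q where q: "\<beta> = \<alpha>" "q \<in> carrier S" "b = q \<cdot> t" by blast
  obtain v where v: "v \<in> carrier S" "a = v \<cdot> b" using ab by (auto simp: triple_iff)
  have "(a, b, \<beta>) = (v \<cdot> q, q, Sigma2) \<cdot>\<^bsub>T_semigrp S\<^esub> (s, t, \<alpha>)"
    using q v triple_closed[OF st] by (simp add: mult_T mult_assoc)
  moreover have "(v \<cdot> q, q, Sigma2) \<in> carrier (T_semigrp S)"
    using q v by (auto simp: carrier_T triple_iff)
  ultimately show "\<exists>w\<in>carrier (T_semigrp S). (a, b, \<beta>) = w \<cdot>\<^bsub>T_semigrp S\<^esub> (s, t, \<alpha>)" by blast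
qed

text \<open>To reach \<open>(a, b, \<beta>)\<close> with \<open>a = v b\<close> from \<open>b = q t x\<close>, the left multiplier already installs
  the factor \<open>v\<close>, giving \<open>(v q t, q t, \<alpha>)\<close>; multiplying by \<open>x\<close> on the right keeps it.\<close>

lemma T_semigrp_factor_iff:
  assumes st: "(s, t, \<alpha>) \<in> triples" and ab: "(a, b, \<beta>) \<in> triples"
  shows "T.factors_through (a, b, \<beta>) (s, t, \<alpha>) \<longleftrightarrow> factors_through b t"
proof
  assume "T.factors_through (a, b, \<beta>) (s, t, \<alpha>)"
  then obtain u c d \<gamma> where u: "u \<in> carrier (T_semigrp S)"
    and cd: "(c, d, \<gamma>) = u \<cdot>\<^bsub>T_semigrp S\<^esub> (s, t, \<alpha>)"
    and "\<exists>w\<in>carrier (T_semigrp S). (a, b, \<beta>) = (c, d, \<gamma>) \<cdot>\<^bsub>T_semigrp S\<^esub> w"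
    unfolding T.factors_through_def by (metis prod_cases3)
  moreover have cd_triple: "(c, d, \<gamma>) \<in> triples"
    using T.mult_closed[OF u, of "(s, t, \<alpha>)"] st cd by (simp add: carrier_T)
  ultimately have "\<exists>x\<in>carrier S. b = d \<cdot> x"
    using right_multiple_T_iff by blast
  moreover have "\<exists>q\<in>carrier S. d = q \<cdot> t"
    using left_multiple_T_iff[OF st cd_triple] u cd by blast
  ultimately show "factors_through b t"
    unfolding factors_through_def by blast
next
  assume "factors_through b t"
  then obtain q x where q: "q \<in> carrier S" and x: "x \<in> carrier S" and b: "b = q \<cdot> t \<cdot> x"
    unfolding factors_through_def by blast
  obtain v where v: "v \<in> carrier S" "a = v \<cdot> b" using ab by (auto simp: triple_iff)
  have t: "t \<in> carrier S" using st by (rule triple_closed)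
  have mid: "(v \<cdot> (q \<cdot> t), q \<cdot> t, \<alpha>) \<in> triples"
    using q t v by (auto simp: triple_iff mult_closed)
  have "\<exists>w\<in>carrier (T_semigrp S). (v \<cdot> (q \<cdot> t), q \<cdot> t, \<alpha>) = w \<cdot>\<^bsub>T_semigrp S\<^esub> (s, t, \<alpha>)"
    using left_multiple_T_iff[OF st mid] q by blast
  moreover have "\<exists>w\<in>carrier (T_semigrp S).
      (a, b, \<beta>) = (v \<cdot> (q \<cdot> t), q \<cdot> t, \<alpha>) \<cdot>\<^bsub>T_semigrp S\<^esub> w"
    using right_multiple_T_iff[OF mid] q t v x b by (auto simp: mult_assoc mult_closed)
  ultimately show "T.factors_through (a, b, \<beta>) (s, t, \<alpha>)"
    unfolding T.factors_through_def by metis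
qed

lemma T_semigrp_bisimilar_iff:
  assumes st: "(s, t, \<alpha>) \<in> triples" and ab: "(a, b, \<beta>) \<in> triples"
  shows "T.bisimilar (s, t, \<alpha>) (a, b, \<beta>) \<longleftrightarrow> bisimilar t b"
proof
  assume "T.bisimilar (s, t, \<alpha>) (a, b, \<beta>)"
  then obtain c d \<gamma> where cd: "(c, d, \<gamma>) \<in> triples"
    and st_cd: "\<exists>w\<in>carrier (T_semigrp S). (s, t, \<alpha>) = w \<cdot>\<^bsub>T_semigrp S\<^esub> (c, d, \<gamma>)"
    and cd_st: "\<exists>w\<in>carrier (T_semigrp S). (c, d, \<gamma>) = w \<cdot>\<^bsub>T_semigrp S\<^esub> (s, t, \<alpha>)"
    and cd_ab: "\<exists>w\<in>carrier (T_semigrp S). (c, d, \<gamma>) = (a, b, \<beta>) \<cdot>\<^bsub>T_semigrp S\<^esub> w"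
    and ab_cd: "\<exists>w\<in>carrier (T_semigrp S). (a, b, \<beta>) = (c, d, \<gamma>) \<cdot>\<^bsub>T_semigrp S\<^esub> w"
    unfolding T.bisimilar_def by (metis carrier_T prod_cases3)
  have "\<exists>q\<in>carrier S. t = q \<cdot> d" "\<exists>q\<in>carrier S. d = q \<cdot> t"
    using st_cd cd_st left_multiple_T_iff[OF cd st] left_multiple_T_iff[OF st cd] by simp_all
  moreover have "\<exists>x\<in>carrier S. d = b \<cdot> x" "\<exists>x\<in>carrier S. b = d \<cdot> x"
    using cd_ab ab_cd right_multiple_T_iff[OF ab] right_multiple_T_iff[OF cd] by metis+
  ultimately show "bisimilar t b"
    unfolding bisimilar_def using triple_closed[OF cd] by (intro bexI[of _ d]) simp_all
next
  assume "bisimilar t b"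
  then obtain d where d: "d \<in> carrier S"
    and td: "\<exists>u\<in>carrier S. t = u \<cdot> d" and dt: "\<exists>u\<in>carrier S. d = u \<cdot> t"
    and db: "\<exists>x\<in>carrier S. d = b \<cdot> x" and bd: "\<exists>x\<in>carrier S. b = d \<cdot> x"
    unfolding bisimilar_def by blast
  obtain v where v: "v \<in> carrier S" "a = v \<cdot> b" and b: "b \<in> carrier S"
    using ab by (auto simp: triple_iff)
  \<comment> \<open>Moving from \<open>b\<close> to \<open>d\<close> on the right keeps the factor \<open>v\<close>, which dictates the first entry
    of the linking triple; its selector must be that of the \<open>\<L>\<close>-related triple.\<close>
  have cd: "(v \<cdot> d, d, \<alpha>) \<in> triples" using v d by (auto simp: triple_iff)
  have "\<exists>x\<in>carrier S. v \<cdot> d = a \<cdot> x \<and> d = b \<cdot> x"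
    using db v b by (auto simp: mult_assoc)
  moreover have "\<exists>x\<in>carrier S. a = (v \<cdot> d) \<cdot> x \<and> b = d \<cdot> x"
    using bd v d by (auto simp: mult_assoc)
  ultimately show "T.bisimilar (s, t, \<alpha>) (a, b, \<beta>)"
    unfolding T.bisimilar_def
    by (intro bexI[of _ "(v \<cdot> d, d, \<alpha>)"])
      (simp_all add: td dt cd[folded carrier_T] left_multiple_T_iff[OF cd st]
        left_multiple_T_iff[OF st cd] right_multiple_T_iff[OF ab] right_multiple_T_iff[OF cd])
qed

lemma idempotents_T_iff:
  "(s, t, \<alpha>) \<in> idempotents (T_semigrp S) \<longleftrightarrow>
     (s, t, \<alpha>) \<in> triples \<and> s \<cdot> select \<alpha> s t = s \<and> t \<cdot> select \<alpha> s t = t"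
  by (auto simp: idempotents_def carrier_T mult_T)

end


section \<open>Passing to \<open>T*(S)\<close>\<close>

locale idempotent_covered_semigrp_with_zero = idempotent_covered_semigrp + semigrp_with_zero S z for z
begin

sublocale locally_unital_semigrp_with_zero S z ..

lemma zero_bar_iff:
  assumes "(s, t, \<alpha>) \<in> triples"
  shows "(s, t, \<alpha>) \<in> zero_bar z \<longleftrightarrow> t = z"
  using assms by (cases \<alpha>) (auto simp: zero_bar_def triple_iff zero_right)

sublocale TI: rees_ideal "T_semigrp S" "zero_bar z"
proof
  have mem: "x \<in> zero_bar z \<longleftrightarrow> (\<exists>\<alpha>. x = (z, z, \<alpha>))" for x
    unfolding zero_bar_def using R2.exhaust by blast
  show "zero_bar z \<subseteq> carrier (T_semigrp S)"
    using diagonal_triple[OF zero_closed] by (auto simp: zero_bar_def carrier_T)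
  show "zero_bar z \<noteq> {}" by (simp add: zero_bar_def)
  fix x i assume x: "x \<in> carrier (T_semigrp S)" and i: "i \<in> zero_bar z"
  obtain s t \<alpha> where st: "x = (s, t, \<alpha>)" "(s, t, \<alpha>) \<in> triples"
    using x by (cases x) (auto simp: carrier_T)
  show "x \<cdot>\<^bsub>T_semigrp S\<^esub> i \<in> zero_bar z"
    using i st by (auto simp: mem mult_T zero_right triple_closed)
  show "i \<cdot>\<^bsub>T_semigrp S\<^esub> x \<in> zero_bar z"
    using i st by (auto simp: mem mult_T zero_left select_closed)
qed

lemma nonzero_triples:
  "carrier (T_semigrp S) - zero_bar z = {(s, t, \<alpha>). (s, t, \<alpha>) \<in> triples \<and> t \<noteq> z}"
  using zero_bar_iff by (auto simp: carrier_T)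

lemma T_trivial_iff: "carrier (T_semigrp S) = zero_bar z \<longleftrightarrow> carrier S = {z}"
proof
  assume "carrier (T_semigrp S) = zero_bar z"
  then have "t = z" if "t \<in> carrier S" for t
    using diagonal_triple[OF that] by (auto simp: carrier_T zero_bar_def)
  then show "carrier S = {z}" using zero_closed by blast
next
  assume "carrier S = {z}"
  then have "carrier (T_semigrp S) - zero_bar z = {}"
    unfolding nonzero_triples by (auto simp: triple_iff)
  then show "carrier (T_semigrp S) = zero_bar z" using TI.ideal_subset by blast
qed

text \<open>Every nonzero \<open>t\<close> is the second entry of a surviving triple, for instance of
  \<open>(t, t, \<sigma>)\<close>, so a condition on second entries ranges over all of \<open>S\<close> apart from \<open>z\<close>.\<close>

lemma nonzero_triple_pairs_iff:
  assumes P: "\<And>s t \<alpha> a b \<beta>. \<lbrakk>(s, t, \<alpha>) \<in> triples; (a, b, \<beta>) \<in> triples\<rbrakk> \<Longrightarrow>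
    P (s, t, \<alpha>) (a, b, \<beta>) \<longleftrightarrow> Q t b"
  shows "(\<forall>x\<in>carrier (T_semigrp S) - zero_bar z. \<forall>y\<in>carrier (T_semigrp S) - zero_bar z. P x y) \<longleftrightarrow>
    (\<forall>t\<in>carrier S - {z}. \<forall>b\<in>carrier S - {z}. Q t b)"
proof
  assume L: "\<forall>x\<in>carrier (T_semigrp S) - zero_bar z. \<forall>y\<in>carrier (T_semigrp S) - zero_bar z. P x y"
  show "\<forall>t\<in>carrier S - {z}. \<forall>b\<in>carrier S - {z}. Q t b"
  proof (intro ballI)
    fix t b assume "t \<in> carrier S - {z}" "b \<in> carrier S - {z}"
    then show "Q t b"
      using L P[of t t Sigma2 b b Sigma2] by (simp add: nonzero_triples diagonal_triple)
  qed
next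
  assume "\<forall>t\<in>carrier S - {z}. \<forall>b\<in>carrier S - {z}. Q t b"
  then show "\<forall>x\<in>carrier (T_semigrp S) - zero_bar z. \<forall>y\<in>carrier (T_semigrp S) - zero_bar z. P x y"
    by (auto simp: nonzero_triples P triple_closed)
qed

lemma zero_simple_T_star_iff: "zero_simple (T_star S z) (zero_bar z) \<longleftrightarrow> zero_simple S z"
  unfolding T_star_def TI.rees_zero_simple_iff zero_simple_iff T_trivial_iff
  by (subst nonzero_triple_pairs_iff[where Q = factors_through]) (auto simp: T_semigrp_factor_iff)

lemma zero_bisimple_T_star_iff: "zero_bisimple (T_star S z) (zero_bar z) \<longleftrightarrow> zero_bisimple S z"
  unfolding T_star_def TI.rees_zero_bisimple_iff zero_bisimple_iff T_trivial_iff
  by (subst nonzero_triple_pairs_iff[where Q = bisimilar]) (auto simp: T_semigrp_bisimilar_iff)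

lemma nonzero_idempotents_T_iff:
  "(s, t, \<alpha>) \<in> idempotents (T_semigrp S) - zero_bar z \<longleftrightarrow>
     (s, t, \<alpha>) \<in> triples \<and> s \<cdot> select \<alpha> s t = s \<and> t \<cdot> select \<alpha> s t = t \<and> t \<noteq> z"
  using zero_bar_iff by (auto simp: idempotents_T_iff)

text \<open>If \<open>(s, t, \<alpha>)\<close> is idempotent, then so is its selected entry \<open>x\<close>, and each idempotent \<open>g\<close>
  below \<open>x\<close> gives the idempotent \<open>(s g, t g, \<alpha>)\<close> below the triple, whose selected entry is
  \<open>x g = g\<close>. Hence \<open>x\<close> is primitive when the triple is. Conversely \<open>(e, e, \<sigma>)\<close> is primitive
  when \<open>e\<close> is.\<close>

lemma primitive_idempotent_T_star_iff:
  "(\<exists>X. primitive_idempotent (T_star S z) (zero_bar z) X) \<longleftrightarrow> (\<exists>e. primitive_idempotent S z e)"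
proof -
  let ?T = "T_semigrp S"
  let ?N = "idempotents ?T - zero_bar z"
  have "(\<exists>x\<in>?N. \<forall>y\<in>?N. x \<cdot>\<^bsub>?T\<^esub> y = y \<and> y \<cdot>\<^bsub>?T\<^esub> x = y \<longrightarrow> x = y) \<longleftrightarrow>
    (\<exists>e. primitive_idempotent S z e)"
  proof
    assume "\<exists>x\<in>?N. \<forall>y\<in>?N. x \<cdot>\<^bsub>?T\<^esub> y = y \<and> y \<cdot>\<^bsub>?T\<^esub> x = y \<longrightarrow> x = y"
    then obtain s t \<alpha> where N: "(s, t, \<alpha>) \<in> ?N"
      and prim: "\<And>y. y \<in> ?N \<Longrightarrow> (s, t, \<alpha>) \<cdot>\<^bsub>?T\<^esub> y = y \<Longrightarrow> y \<cdot>\<^bsub>?T\<^esub> (s, t, \<alpha>) = y \<Longrightarrow> (s, t, \<alpha>) = y"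
      by (metis prod_cases3)
    define x where "x = select \<alpha> s t"
    have st: "(s, t, \<alpha>) \<in> triples" and sx: "s \<cdot> x = s" and tx: "t \<cdot> x = t" and "t \<noteq> z"
      using N unfolding nonzero_idempotents_T_iff x_def by auto
    have s: "s \<in> carrier S" and t: "t \<in> carrier S" and x: "x \<in> carrier S"
      using triple_closed[OF st] select_closed[OF st] by (auto simp: x_def)
    have xx: "x \<cdot> x = x" using select_mult[of \<alpha> s x t] sx tx by (simp add: x_def)
    have "x \<noteq> z" using tx \<open>t \<noteq> z\<close> t by (auto simp: zero_right)
    have "x = g" if g: "g \<in> carrier S" "g \<cdot> g = g" and xg: "x \<cdot> g = g" and gx: "g \<cdot> x = g"
      and "g \<noteq> z" for g
    proof -
      let ?y = "(s \<cdot> g, t \<cdot> g, \<alpha>)"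
      have sel: "select \<alpha> (s \<cdot> g) (t \<cdot> g) = g" by (simp add: select_mult xg flip: x_def)
      have y: "?y \<in> triples" using triple_act[OF st] g by blast
      then have "t \<cdot> g \<noteq> z"
        using sel zero_bar_iff[OF y] \<open>g \<noteq> z\<close> by (cases \<alpha>) (auto simp: zero_bar_def)
      then have "?y \<in> ?N"
        unfolding nonzero_idempotents_T_iff sel using y g s t by (simp add: mult_assoc)
      moreover have "(s, t, \<alpha>) \<cdot>\<^bsub>?T\<^esub> ?y = ?y" by (simp add: mult_T sel)
      moreover have "?y \<cdot>\<^bsub>?T\<^esub> (s, t, \<alpha>) = ?y"
        using g s t x gx by (simp add: mult_T mult_assoc flip: x_def)
      ultimately have "(s, t, \<alpha>) = ?y" by (rule prim)
      then show ?thesis using sel by (simp add: x_def)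
    qed
    then have "primitive_idempotent S z x"
      using x xx \<open>x \<noteq> z\<close> by (auto simp: primitive_idempotent_def idempotents_def)
    then show "\<exists>e. primitive_idempotent S z e" by blast
  next
    assume "\<exists>e. primitive_idempotent S z e"
    then obtain e where e: "e \<in> carrier S" "e \<cdot> e = e" "e \<noteq> z"
      and prim: "\<And>g. \<lbrakk>g \<in> carrier S; g \<cdot> g = g; e \<cdot> g = g; g \<cdot> e = g; g \<noteq> z\<rbrakk> \<Longrightarrow> e = g"
      by (auto simp: primitive_idempotent_def idempotents_def)
    have "(e, e, Sigma2) \<in> ?N"
      unfolding nonzero_idempotents_T_iff using e by (simp add: diagonal_triple)
    moreover have "(e, e, Sigma2) = y"
      if "y \<in> ?N" and ey: "(e, e, Sigma2) \<cdot>\<^bsub>?T\<^esub> y = y" and ye: "y \<cdot>\<^bsub>?T\<^esub> (e, e, Sigma2) = y" for y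
    proof -
      obtain s t \<alpha> where y: "y = (s, t, \<alpha>)" by (cases y)
      have "e \<cdot> t = s" "e \<cdot> t = t" "t \<cdot> e = t" "\<alpha> = Sigma2"
        using ey ye by (auto simp: y mult_T)
      moreover have "t \<in> carrier S" "t \<cdot> t = t" "t \<noteq> z"
        using that(1) \<open>\<alpha> = Sigma2\<close> unfolding y nonzero_idempotents_T_iff
        by (auto simp: triple_closed)
      ultimately show ?thesis using prim[of t] y by auto
    qed
    ultimately show "\<exists>x\<in>?N. \<forall>y\<in>?N. x \<cdot>\<^bsub>?T\<^esub> y = y \<and> y \<cdot>\<^bsub>?T\<^esub> x = y \<longrightarrow> x = y" by blast
  qed
  then show ?thesis unfolding T_star_def TI.rees_primitive_idempotent_iff .
qed

end

theorem proposition4p9: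
  fixes S :: "'a sgrp" and z :: 'a
  assumes "semigrp_with_zero S z"
    and "idempotent_covered S"
  shows "(zero_simple S z \<longleftrightarrow> zero_simple (T_star S z) (zero_bar z))
       \<and> (zero_bisimple S z \<longleftrightarrow> zero_bisimple (T_star S z) (zero_bar z))
       \<and> (completely_zero_simple S z \<longleftrightarrow> completely_zero_simple (T_star S z) (zero_bar z))"
proof -
  interpret semigrp_with_zero S z by fact
  interpret idempotent_covered_semigrp_with_zero S z
    by unfold_locales fact
  show ?thesis
    by (simp add: completely_zero_simple_def zero_simple_T_star_iff zero_bisimple_T_star_iff
        primitive_idempotent_T_star_iff)
qed

end
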